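(* Let $R$ be a $*$-ring and let $a,b,c\in R$ with $\ell(b)=\ell(c)$. Then $a\in R_{lh(b,c)}^{\mathrm{core}}$ (i.e. $a$ has a left hybrid core-$(b,c)$-inverse) if and only if both of the following hold: (1) $(ac)^2$ is EP; (2) $\ell(ca)=\ell(b)$ and $(ac)^{\pi}c=(ca)^{\pi}a=0$.
   Context: A $*$-ring is an associative ring with identity with an involution $x\mapsto x^*$ satisfying $(x+y)^*=x^*+y^*$, $(xy)^*=y^*x^*$, $(x^* )^*=x$. For $x\in R$, $\ell(x)=\{r\in R: rx=0\}$. Core inverse: $a\in R$ is core invertible ($a\in R^{\mathrm{core}}$) if there is $x\in R$ with $ax^2=x$, $(ax)^*=ax$, $xa^2=a$; such $x$ is unique and denoted $a^{\mathrm{core}}$. Left hybrid $(b,c)$-inverse: $a\in R_{lh}^{(b,c)}$ if there is $x\in R$ with $xax=x$, $\ell(x)=\ell(b)$, $Rx=Rc$; such $x$ is unique and denoted $a_{lh}^{(b,c)}$. Left hybrid core-$(b,c)$-inverse: $a\in R_{lh(b,c)}^{\mathrm{core}}$ if $a\in R^{\mathrm{core}}$, $a\in R_{lh}^{(b,c)}$ and $a^{\mathrm{core}}=a_{lh}^{(b,c)}$. Drazin inverse: $x\in R$ is Drazin invertible if there is $z=x^D$ with $xz=zx$, $zxz=z$, $x^{k+1}z=x^k$ for some $k\in\mathbb N$; if one can take $k=1$, $x$ is group invertible and $x^D=x^{\#}$. For Drazin invertible $x$, $x^{\pi}=1-xx^D$. An element $x$ is EP if it is group invertible and $(xx^{\#})^*=xx^{\#}$.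 (If $(ac)^2$ is EP then $ac$ and $ca$ are Drazin invertible, so the expressions in (2) make sense.) *)

theory Defs
  imports Main
begin

text \<open>
  The class \<^class>\<open>ring_1\<close> is not used because it excludes the zero ring.
\<close>

class star_ring = ring + monoid_mult +
  fixes star :: "'a \<Rightarrow> 'a"
  assumes star_add: "star (x + y) = star x + star y"
    and star_mult: "star (x * y) = star y * star x"
    and star_star: "star (star x) = x"

definition left_ann :: "'a::star_ring \<Rightarrow> 'a set" where
  "left_ann x = {r. r * x = 0}"

definition left_ideal :: "'a::star_ring \<Rightarrow> 'a set" where
  "left_ideal x = {r * x | r. True}"


subsection \<open>Core inverse\<close>

definition is_core_inverse :: "'a::star_ring \<Rightarrow> 'a \<Rightarrow> bool" where
  "is_core_inverse a x \<longleftrightarrow> a * x ^ 2 = x \<and> star (a * x) = a * x \<and> x * a ^ 2 = a"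

definition core_invertible :: "'a::star_ring \<Rightarrow> bool" where
  "core_invertible a \<longleftrightarrow> (\<exists>x. is_core_inverse a x)"

definition core_inverse :: "'a::star_ring \<Rightarrow> 'a" where
  "core_inverse a = (THE x. is_core_inverse a x)"

lemma core_inverse_unique:
  assumes "is_core_inverse a x" "is_core_inverse a y"
  shows "x = y"
proof -
  have x: "a * (x * x) = x" "star (a * x) = a * x" "x * (a * a) = a"
    and y: "a * (y * y) = y" "star (a * y) = a * y" "y * (a * a) = a"
    using assms by (auto simp: is_core_inverse_def power2_eq_square)
  have axa: "a * (x * a) = a" and aya: "a * (y * a) = a"
    using x y by (metis mult.assoc)+
  have axay: "a * x * (a * y) = a * y" and ayax: "a * y * (a * x) = a * x"
    using axa aya by (metis mult.assoc)+
  have eq: "a * x = a * y"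
    using axay ayax x(2) y(2) by (metis star_mult)
  have xax: "x * (a * x) = x" and yay: "y * (a * y) = y"
    using x y by (metis mult.assoc)+
  have xa: "x * (a * y) = y"
    using x(3) y(1) by (metis mult.assoc)
  show ?thesis using xa xax eq by metis
qed

lemma core_inverse_eq: "is_core_inverse a x \<Longrightarrow> core_inverse a = x"
  unfolding core_inverse_def by (blast intro: core_inverse_unique)


subsection \<open>Left hybrid inverses\<close>

definition is_lh_inverse :: "'a::star_ring \<Rightarrow> 'a \<Rightarrow> 'a \<Rightarrow> 'a \<Rightarrow> bool" where
  "is_lh_inverse b c a x \<longleftrightarrow>
     x * a * x = x \<and> left_ann x = left_ann b \<and> left_ideal x = left_ideal c"

definition lh_invertible :: "'a::star_ring \<Rightarrow> 'a \<Rightarrow> 'a \<Rightarrow> bool" where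
  "lh_invertible b c a \<longleftrightarrow> (\<exists>x. is_lh_inverse b c a x)"

definition lh_inverse :: "'a::star_ring \<Rightarrow> 'a \<Rightarrow> 'a \<Rightarrow> 'a" where
  "lh_inverse b c a = (THE x. is_lh_inverse b c a x)"

lemma lh_inverse_unique:
  assumes "is_lh_inverse b c a x" "is_lh_inverse b c a y"
  shows "x = y"
proof -
  have x: "x * (a * x) = x" and y: "y * (a * y) = y"
    and ann: "left_ann x = left_ann y" and ideal: "left_ideal x = left_ideal y"
    using assms by (auto simp: is_lh_inverse_def mult.assoc)
  have "1 - x * a \<in> left_ann x"
    using x by (simp add: left_ann_def left_diff_distrib mult.assoc)
  then have 1: "x * (a * y) = y"
    unfolding ann by (simp add: left_ann_def left_diff_distrib mult.assoc)
  have "x \<in> left_ideal x" unfolding left_ideal_def by (metis (mono_tags) mem_Collect_eq mult_1_left)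
  then obtain s where s: "x = s * y" unfolding ideal by (auto simp: left_ideal_def)
  have "x * (a * y) = x" using y s by (metis mult.assoc)
  with 1 show ?thesis by simp
qed

lemma lh_inverse_eq: "is_lh_inverse b c a x \<Longrightarrow> lh_inverse b c a = x"
  unfolding lh_inverse_def by (blast intro: lh_inverse_unique)

definition lh_core_invertible :: "'a::star_ring \<Rightarrow> 'a \<Rightarrow> 'a \<Rightarrow> bool" where
  "lh_core_invertible b c a \<longleftrightarrow>
     core_invertible a \<and> lh_invertible b c a \<and> core_inverse a = lh_inverse b c a"


subsection \<open>Drazin inverse, group inverse, EP elements\<close>

definition is_drazin_inverse_at :: "nat \<Rightarrow> 'a::star_ring \<Rightarrow> 'a \<Rightarrow> bool" where
  "is_drazin_inverse_at k x z \<longleftrightarrow>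
     x * z = z * x \<and> z * x * z = z \<and> x ^ (k + 1) * z = x ^ k"

definition is_drazin_inverse :: "'a::star_ring \<Rightarrow> 'a \<Rightarrow> bool" where
  "is_drazin_inverse x z \<longleftrightarrow> (\<exists>k. is_drazin_inverse_at k x z)"

definition drazin_invertible :: "'a::star_ring \<Rightarrow> bool" where
  "drazin_invertible x \<longleftrightarrow> (\<exists>z. is_drazin_inverse x z)"

definition drazin_inverse :: "'a::star_ring \<Rightarrow> 'a" where
  "drazin_inverse x = (THE z. is_drazin_inverse x z)"

lemma is_drazin_inverse_at_mono:
  assumes "is_drazin_inverse_at k x z" "k \<le> l"
  shows "is_drazin_inverse_at l x z"
proof -
  obtain m where l: "l = m + k" using assms(2) by (metis le_add_diff_inverse2)
  have "x ^ (k + 1) * z = x ^ k"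
    using assms(1) by (simp add: is_drazin_inverse_at_def)
  then have "x ^ m * (x ^ (k + 1) * z) = x ^ m * x ^ k" by simp
  then have "x ^ (l + 1) * z = x ^ l"
    unfolding l by (simp only: power_add mult.assoc)
  then show ?thesis using assms(1) by (simp add: is_drazin_inverse_at_def)
qed

lemma is_drazin_inverse_at_power:
  assumes "is_drazin_inverse_at k x z"
  shows "z ^ (n + 1) * x ^ n = z" and "x ^ n * z ^ (n + 1) = z"
proof -
  have c: "x * z = z * x" and z: "z * (x * z) = z"
    using assms by (auto simp: is_drazin_inverse_at_def mult.assoc)
  have cn: "x ^ n * z = z * x ^ n" for n using c by (metis power_commuting_commutes)
  show 1: "z ^ (n + 1) * x ^ n = z" for n
  proof (induction n)
    case (Suc n)
    have "z ^ (Suc n + 1) * x ^ Suc n = z * (z ^ (n + 1) * x ^ n) * x"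
      unfolding power_Suc2[of x n] by (simp add: mult.assoc)
    also have "\<dots> = z * z * x" by (simp only: Suc)
    also have "\<dots> = z" using z c by (simp add: mult.assoc)
    finally show ?case .
  qed simp
  show "x ^ n * z ^ (n + 1) = z"
    using 1[of n] cn[of n] by (metis power_commuting_commutes)
qed

lemma drazin_inverse_unique:
  assumes "is_drazin_inverse x y" "is_drazin_inverse x z"
  shows "y = z"
proof -
  obtain k l where "is_drazin_inverse_at k x y" "is_drazin_inverse_at l x z"
    using assms by (auto simp: is_drazin_inverse_def)
  then obtain m where y: "is_drazin_inverse_at m x y" and z: "is_drazin_inverse_at m x z"
    by (meson is_drazin_inverse_at_mono nat_le_linear)
  have my: "x ^ m * (x * y) = x ^ m" and mz: "x ^ m * (x * z) = x ^ m"
    using y z by (auto simp: is_drazin_inverse_at_def power_Suc2 mult.assoc simp del: power_Suc)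
  have cy: "x * y = y * x" using y by (simp add: is_drazin_inverse_at_def)
  have comm: "x ^ m * (y * x) = (y * x) * x ^ m"
    using cy by (metis mult.assoc power_commutes power_commuting_commutes)
  have "y = y * (x * z)"
    using is_drazin_inverse_at_power(1)[OF y, of m] mz by (metis mult.assoc)
  moreover have "z = y * (x * z)"
    using is_drazin_inverse_at_power(2)[OF z, of m] my cy comm by (metis mult.assoc)
  ultimately show ?thesis by simp
qed

lemma drazin_inverse_eq: "is_drazin_inverse x z \<Longrightarrow> drazin_inverse x = z"
  unfolding drazin_inverse_def by (blast intro: drazin_inverse_unique)

text \<open>
  The spectral idempotent \<open>x\<^sup>\<pi>\<close>; meaningful only for Drazin invertible \<open>x\<close>.
\<close>

definition spectral_idem :: "'a::star_ring \<Rightarrow> 'a" where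
  "spectral_idem x = 1 - x * drazin_inverse x"

definition group_invertible :: "'a::star_ring \<Rightarrow> bool" where
  "group_invertible x \<longleftrightarrow> (\<exists>z. is_drazin_inverse_at 1 x z)"

definition group_inverse :: "'a::star_ring \<Rightarrow> 'a" where
  "group_inverse x = (THE z. is_drazin_inverse_at 1 x z)"

lemma group_inverse_eq: "is_drazin_inverse_at 1 x z \<Longrightarrow> group_inverse x = z"
  unfolding group_inverse_def
  by (rule the_equality) (use drazin_inverse_unique is_drazin_inverse_def in blast)+

lemma group_inverse_eq_drazin_inverse:
  "group_invertible x \<Longrightarrow> group_inverse x = drazin_inverse x"
  by (metis drazin_inverse_eq group_inverse_eq group_invertible_def is_drazin_inverse_def)

definition EP :: "'a::star_ring \<Rightarrow> bool" where
  "EP x \<longleftrightarrow> group_invertible x \<and> star (x * group_inverse x) = x * group_inverse x"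

end

theory Submission
  imports Defs
begin

text \<open>
  Let \<open>x\<close> be the core inverse of \<open>a\<close> and \<open>e = a x\<close>, a projection. If \<open>x\<close> is also the left hybrid
  \<open>(b, c)\<close>-inverse, then \<open>x\<close>, \<open>a e\<close> and \<open>c\<close> are units of the corner ring \<open>e R e\<close>; hence so is \<open>a c\<close>,
  and \<open>a c\<close> is EP with spectral idempotent \<open>1 - e\<close>. Conversely, if \<open>d\<close> is the Drazin inverse of
  \<open>a c\<close>, then \<open>c d\<close> has all the required properties. Cline's formula \<open>(c a)\<^sup>D = c d\<^sup>2 a\<close> links the
  spectral idempotents of \<open>a c\<close> and \<open>c a\<close>.
\<close>

lemma left_annI: "r * x = 0 \<Longrightarrow> r \<in> left_ann x"
  by (simp add: left_ann_def)

lemma left_annD: "r \<in> left_ann x \<Longrightarrow> r * x = 0"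
  by (simp add: left_ann_def)

text \<open>Equal annihilators need not give a factorization \<open>x = y * s\<close>. What they do
  give is transport: an identity between left factors, once checked against \<open>x\<close>, holds
  against \<open>y\<close>.\<close>

lemma left_ann_eqD:
  assumes "left_ann x = left_ann y" "r * x = s * x"
  shows "r * y = s * y"
proof -
  have "(r - s) * x = 0" using assms(2) by (simp add: left_diff_distrib)
  then have "(r - s) * y = 0" using assms(1) left_annI left_annD by blast
  then show ?thesis by (simp add: left_diff_distrib)
qed

lemma left_ann_eqI:
  assumes "x = y * s" "y = x * t"
  shows "left_ann x = left_ann y"
proof -
  have "r * x = 0 \<longleftrightarrow> r * y = 0" for r
    using assms by (metis mult.assoc mult_zero_left)
  then show ?thesis by (simp add: left_ann_def)
qed

lemma left_ideal_self: "x \<in> left_ideal x"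
  unfolding left_ideal_def by (metis (mono_tags) mem_Collect_eq mult_1_left)

lemma left_ideal_eqI:
  assumes "x = s * y" "y = t * x"
  shows "left_ideal x = left_ideal y"
proof -
  have "(\<exists>r. z = r * x) \<longleftrightarrow> (\<exists>r. z = r * y)" for z
    using assms by (metis mult.assoc)
  then show ?thesis by (simp add: left_ideal_def)
qed

text \<open>An inverse in a corner ring with unit \<open>e\<close> is a group inverse in the whole
  ring.\<close>

lemma is_drazin_inverse_atI_1:
  assumes "x * z = e" "z * x = e" "e * z = z" "e * x = x"
  shows "is_drazin_inverse_at 1 x z"
  unfolding is_drazin_inverse_at_def
  using assms by (simp add: power2_eq_square) (metis mult.assoc)

text \<open>For \<open>e = w * z\<close>, both \<open>e * y\<close> and \<open>y * e\<close> equal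
  \<open>e * y * e\<close>, so \<open>y\<close> commutes with \<open>e\<close>, and then with
  \<open>z\<close>.\<close>

lemma group_inverse_commute:
  assumes z: "is_drazin_inverse_at 1 w z" and y: "w * y = y * w"
  shows "z * y = y * z"
proof -
  have c: "w * z = z * w" and zwz: "z * (w * z) = z" and wwz: "w * (w * z) = w"
    using z by (auto simp: is_drazin_inverse_at_def mult.assoc power2_eq_square)
  have "w * z * y = w * z * y * (w * z)" and "y * (w * z) = w * z * y * (w * z)"
    using c zwz wwz y by (metis mult.assoc)+
  then have ey: "w * z * y = y * (w * z)" by simp
  have "z * y = z * (w * z * y)" using zwz by (metis mult.assoc)
  also have "\<dots> = z * w * y * z" using ey y by (metis mult.assoc)
  also have "\<dots> = y * (w * z) * z" using ey c by simp
  also have "\<dots> = y * z" using c zwz by (metis mult.assoc)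
  finally show ?thesis .
qed

text \<open>The index is 2 because \<open>y ^ 4 * z = y ^ 2\<close> reads
  \<open>y ^ 3 * (y * z) = y ^ 2\<close>.\<close>

lemma drazin_inverse_of_square:
  assumes "is_drazin_inverse_at 1 (y ^ 2) z"
  shows "is_drazin_inverse_at 2 y (y * z)"
proof -
  have c: "z * y = y * z"
    by (rule group_inverse_commute[OF assms]) (simp add: power2_eq_square mult.assoc)
  have zwz: "z * (y * (y * z)) = z" and wwz: "y * (y * (y * (y * z))) = y * y"
    using assms by (auto simp: is_drazin_inverse_at_def mult.assoc power2_eq_square)
  have "y * z * y * (y * z) = y * z" using zwz c by (metis mult.assoc)
  then show ?thesis
    using c wwz by (simp add: is_drazin_inverse_at_def mult.assoc power2_eq_square numeral_3_eq_3)
qed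

lemma power_mult_shift: "(c * a) ^ Suc n = c * (a * c) ^ n * (a::'a::monoid_mult)"
  by (induction n) (simp_all add: mult.assoc)

text \<open>The index grows by one since \<open>(c * a) ^ (k + 1)\<close> wraps
  \<open>(a * c) ^ k\<close> between \<open>c\<close> and \<open>a\<close>.\<close>

lemma cline_formula:
  assumes "is_drazin_inverse_at k (a * c) d"
  shows "is_drazin_inverse_at (k + 1) (c * a) (c * d ^ 2 * a)"
proof -
  have cm: "a * (c * d) = d * (a * c)" and d: "d * (a * (c * d)) = d"
    and k: "(a * c) ^ (k + 1) * d = (a * c) ^ k"
    using assms by (auto simp: is_drazin_inverse_at_def mult.assoc)
  have l: "c * a * (c * d ^ 2 * a) = c * d * a" and r: "c * d ^ 2 * a * (c * a) = c * d * a"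
    using cm d by (simp_all add: power2_eq_square) (metis mult.assoc)+
  have dd: "c * d ^ 2 * a * (c * a) * (c * d ^ 2 * a) = c * d ^ 2 * a"
    unfolding r using cm d by (simp add: power2_eq_square) (metis mult.assoc)
  have "(c * a) ^ (k + 1 + 1) * (c * d ^ 2 * a) = (c * a) ^ Suc k * (c * a * (c * d ^ 2 * a))"
    by (simp only: power_Suc2 Suc_eq_plus1[symmetric] mult.assoc)
  also have "\<dots> = c * ((a * c) ^ (k + 1) * d) * a"
    unfolding l power_mult_shift by (simp add: mult.assoc power_Suc2 del: power_Suc)
  also have "\<dots> = (c * a) ^ (k + 1)"
    unfolding k by (simp add: power_mult_shift del: power_Suc)
  finally show ?thesis using l r dd by (simp add: is_drazin_inverse_at_def)
qed

lemma spectral_idem_eq: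
  "is_drazin_inverse_at k x z \<Longrightarrow> spectral_idem x = 1 - x * z"
  by (metis drazin_inverse_eq is_drazin_inverse_def spectral_idem_def)

lemma spectral_idem_swap:
  assumes "is_drazin_inverse_at k (a * c) d"
  shows "spectral_idem (c * a) = 1 - c * d * a"
proof -
  have "a * c * d ^ 2 = d"
    using assms by (simp add: is_drazin_inverse_at_def power2_eq_square flip: mult.assoc)
  then have "c * a * (c * d ^ 2 * a) = c * d * a" by (metis mult.assoc)
  then show ?thesis using spectral_idem_eq[OF cline_formula[OF assms]] by simp
qed

lemma EP_I: "is_drazin_inverse_at 1 x z \<Longrightarrow> star (x * z) = x * z \<Longrightarrow> EP x"
  by (metis EP_def group_inverse_eq group_invertible_def)

text \<open>Uniqueness of both inverses turns the equality of the two \<open>THE\<close> terms into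
  a common witness.\<close>

lemma lh_core_invertible_iff:
  "lh_core_invertible b c a \<longleftrightarrow> (\<exists>x. is_core_inverse a x \<and> is_lh_inverse b c a x)"
  unfolding lh_core_invertible_def core_invertible_def lh_invertible_def
  by (metis core_inverse_eq lh_inverse_eq)

lemma core_and_lh_inverseD:
  assumes ann: "left_ann b = left_ann c"
    and x: "is_core_inverse a x" "is_lh_inverse b c a x"
  shows "EP ((a * c) ^ 2)" and "left_ann (c * a) = left_ann b"
    and "spectral_idem (a * c) * c = 0" and "spectral_idem (c * a) * a = 0"
proof -
  define e where "e = a * x"
  have axx: "a * x * x = x" and se: "star e = e" and xaa: "x * a * a = a"
    using x(1) by (simp_all add: is_core_inverse_def power2_eq_square mult.assoc e_def)
  have xax: "x * a * x = x" and annx: "left_ann x = left_ann c" and idl: "left_ideal x = left_ideal c"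
    using x(2) ann by (simp_all add: is_lh_inverse_def)
  have ex: "e * x = x" and xe: "x * e = x" and ea: "e * a = a" and ee: "e * e = e"
    using axx xax xaa by (metis e_def mult.assoc)+
  obtain s where s: "x = s * c"
    using left_ideal_self[of x] unfolding idl by (auto simp: left_ideal_def)
  obtain t where t: "c = t * x"
    using left_ideal_self[of c] unfolding idl[symmetric] by (auto simp: left_ideal_def)
  have ec: "e * c = c" using left_ann_eqD[OF annx, of e 1] ex by simp
  have ce: "c * e = c" using t xe by (metis mult.assoc)
  have xac: "x * a * c = c" using left_ann_eqD[OF annx, of "x * a" 1] xax by simp
  \<comment> \<open>From \<open>x = s * c\<close> comes \<open>a * s * c = e\<close>, so
    \<open>a * s\<close> inverts \<open>c\<close> from the left; the factor \<open>e\<close> cuts it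
    down to the corner ring.\<close>
  define u where "u = a * s * e"
  have uc: "u * c = e" using ec s by (metis e_def mult.assoc u_def)
  \<comment> \<open>To make \<open>u\<close> a right inverse too, \<open>c * u\<close> is shown to
    fix \<open>c\<close>, hence \<open>x\<close>, hence \<open>x * a * e = e\<close>.\<close>
  have "(c * u) * c = 1 * c" using uc ce by (simp add: mult.assoc)
  from left_ann_eqD[OF annx[symmetric] this] have "c * u * (x * a * e) = x * a * e"
    by (metis mult.assoc mult_1_left)
  moreover have "x * a * e = e" using xaa by (simp add: e_def flip: mult.assoc)
  moreover have ue: "u * e = u" by (simp add: u_def mult.assoc ee)
  ultimately have cu: "c * u = e" by (metis mult.assoc)
  have eu: "e * u = u" using ea by (simp add: u_def flip: mult.assoc)
  \<comment> \<open>In the corner ring \<open>x\<close> inverts \<open>a * e\<close> and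
    \<open>u\<close> inverts \<open>c\<close>, so \<open>u * x\<close> inverts
    \<open>a * e * c = a * c\<close>.\<close>
  define d where "d = u * x"
  have yd: "a * c * d = e"
    using cu ex by (metis d_def e_def mult.assoc)
  have dy: "d * (a * c) = e"
    using xac uc by (simp add: d_def mult.assoc)
  have ed: "e * d = d" using eu by (simp add: d_def flip: mult.assoc)
  have ey: "e * (a * c) = a * c" using ea by (simp flip: mult.assoc)
  have D: "is_drazin_inverse_at 1 (a * c) d"
    by (rule is_drazin_inverse_atI_1[OF yd dy ed ey])
  have de: "d * e = d" using xe by (simp add: d_def mult.assoc)
  have ye: "a * c * e = a * c" using ce by (simp add: mult.assoc)
  have y2: "(a * c) ^ 2 * d ^ 2 = e" "d ^ 2 * (a * c) ^ 2 = e"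
    "e * d ^ 2 = d ^ 2" "e * (a * c) ^ 2 = (a * c) ^ 2"
    unfolding power2_eq_square using yd dy ed ey de ye by (metis mult.assoc)+
  show "EP ((a * c) ^ 2)"
    by (rule EP_I[OF is_drazin_inverse_atI_1[OF y2]]) (simp add: y2 se)
  show "left_ann (c * a) = left_ann b"
    unfolding ann by (rule left_ann_eqI[where s = a and t = x]) (simp_all add: mult.assoc ce flip: e_def)
  show "spectral_idem (a * c) * c = 0"
    unfolding spectral_idem_eq[OF D] yd by (simp add: left_diff_distrib ec)
  have "c * d * a = x * a" using cu ex by (metis d_def mult.assoc)
  then show "spectral_idem (c * a) * a = 0"
    unfolding spectral_idem_swap[OF D] by (simp add: left_diff_distrib xaa)
qed

lemma core_and_lh_inverseI:
  assumes ann: "left_ann b = left_ann c"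
    and D: "is_drazin_inverse_at k (a * c) d" and star: "star (a * c * d) = a * c * d"
    and annca: "left_ann (c * a) = left_ann b"
    and pc: "spectral_idem (a * c) * c = 0" and pa: "spectral_idem (c * a) * a = 0"
  shows "is_core_inverse a (c * d)" and "is_lh_inverse b c a (c * d)"
proof -
  define e where "e = a * c * d"
  have e': "d * (a * c) = e" and ed: "e * d = d" and de: "d * e = d"
    using D by (auto simp: is_drazin_inverse_at_def e_def mult.assoc)
  have ec: "e * c = c"
    using pc unfolding spectral_idem_eq[OF D] by (simp add: left_diff_distrib e_def)
  \<comment> \<open>This is already the last core inverse equation for \<open>c * d\<close>.\<close>
  have a: "c * d * a * a = a"
    using pa unfolding spectral_idem_swap[OF D] by (simp add: left_diff_distrib)
  have ea: "e * a = a" using ec a by (metis mult.assoc)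
  have "a * (c * d * (c * d)) = c * d" using ec by (metis e_def mult.assoc)
  then show "is_core_inverse a (c * d)"
    using a star by (simp add: is_core_inverse_def power2_eq_square mult.assoc)
  \<comment> \<open>The left side is \<open>c * e * a\<close>. Replacing \<open>c * a\<close> by
    \<open>c\<close> through the annihilators yields \<open>c * e = c\<close>, which the hybrid
    inverse conditions rest on.\<close>
  have "c * d * a * (c * a) = 1 * (c * a)" using e' ea by (metis mult.assoc mult_1_left)
  then have "c * d * a * c = 1 * c" by (rule left_ann_eqD[OF annca[unfolded ann]])
  then have ce: "c * e = c" using e' by (simp add: mult.assoc)
  show "is_lh_inverse b c a (c * d)"
    unfolding is_lh_inverse_def ann
  proof (intro conjI)
    show "c * d * a * (c * d) = c * d" using e' ed ce by (metis mult.assoc)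
    show "left_ann (c * d) = left_ann c"
      by (rule left_ann_eqI[where s = d and t = "a * c"]) (simp_all add: mult.assoc e' ce)
    show "left_ideal (c * d) = left_ideal c"
    proof (rule left_ideal_eqI)
      show "c * d = c * d * d * a * c" using e' de by (metis mult.assoc)
      show "c = c * a * (c * d)" using ce by (simp add: e_def mult.assoc)
    qed
  qed
qed

theorem theorem3p1:
  fixes a b c :: "'a::star_ring"
  assumes "left_ann b = left_ann c"
  shows "lh_core_invertible b c a \<longleftrightarrow>
    EP ((a * c) ^ 2) \<and>
    (left_ann (c * a) = left_ann b \<and>
     spectral_idem (a * c) * c = 0 \<and> spectral_idem (c * a) * a = 0)"
proof
  assume "lh_core_invertible b c a"
  then show "EP ((a * c) ^ 2) \<and>
    (left_ann (c * a) = left_ann b \<and>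
     spectral_idem (a * c) * c = 0 \<and> spectral_idem (c * a) * a = 0)"
    unfolding lh_core_invertible_iff using core_and_lh_inverseD[OF assms] by blast
next
  assume R: "EP ((a * c) ^ 2) \<and>
    (left_ann (c * a) = left_ann b \<and>
     spectral_idem (a * c) * c = 0 \<and> spectral_idem (c * a) * a = 0)"
  then obtain z where z: "is_drazin_inverse_at 1 ((a * c) ^ 2) z"
    by (auto simp: EP_def group_invertible_def)
  then have "star ((a * c) ^ 2 * z) = (a * c) ^ 2 * z"
    using R by (simp add: EP_def group_inverse_eq)
  \<comment> \<open>The Drazin inverse of \<open>a * c\<close> is \<open>a * c * z\<close>, so
    \<open>a * c\<close> and its square share the same self-adjoint idempotent.\<close>
  then have "star (a * c * (a * c * z)) = a * c * (a * c * z)"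
    by (simp add: power2_eq_square mult.assoc)
  with R show "lh_core_invertible b c a"
    unfolding lh_core_invertible_iff
    using core_and_lh_inverseI[OF assms drazin_inverse_of_square[OF z]] by blast
qed

end
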